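(* Let $\tau$ be a positive integer such that $2^{2^\tau}-1$ has at least two distinct primitive prime divisors. For each $1\le j\le\tau$ let $p_j$ be a primitive prime divisor of $2^{2^j}-1$, let $q$ be a primitive prime divisor of $2^{2^\tau}-1$ with $q\neq p_\tau$, and let $P=p_1p_2\cdots p_\tau$. Let $b>2$ be an integer with $b\equiv 1\pmod P$, and suppose $b$ satisfies one of the following: (i) $b\equiv 0\pmod q$; (ii) $b\equiv 1\pmod q$; (iii) $b\not\equiv 0\pmod q$, $b\not\equiv1\pmod q$, and $\gcd(P,\operatorname{ord}_q(b))=1$. Then there exist infinitely many $b$-repunits that are Riesel numbers.
   Context: For a positive integer $m$, a prime $p$ is a primitive prime divisor of $2^m-1$ if $p\mid 2^m-1$ and $p\nmid 2^\mu-1$ for every positive integer $\mu<m$. $\operatorname{ord}_q(b)$ is the multiplicative order of $b$ modulo $q$. For $b\ge2$ and $t\ge1$, the $b$-repunit $1_b^{(t)}$ is $(b^t-1)/(b-1)$. A Riesel number is an odd positive integer $k$ such that $k\cdot 2^n-1$ is composite for all positive integers $n$. *)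

theory Defs
  imports "HOL-Number_Theory.Number_Theory"
begin

definition primitive_prime_divisor :: "nat \<Rightarrow> nat \<Rightarrow> bool" where
  "primitive_prime_divisor p m \<longleftrightarrow>
     prime p \<and> p dvd 2 ^ m - 1 \<and> (\<forall>\<mu>. 0 < \<mu> \<and> \<mu> < m \<longrightarrow> \<not> p dvd 2 ^ \<mu> - 1)"

text \<open>The division is exact for \<open>b \<ge> 2\<close>, the only case in which repunits are considered.\<close>

definition repunit :: "nat \<Rightarrow> nat \<Rightarrow> nat" where
  "repunit b t = (b ^ t - 1) div (b - 1)"

definition composite :: "nat \<Rightarrow> bool" where
  "composite n \<longleftrightarrow> n > 1 \<and> \<not> prime n"

definition riesel :: "nat \<Rightarrow> bool" where
  "riesel k \<longleftrightarrow> odd k \<and> (\<forall>n>0. composite (k * 2 ^ n - 1))"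

end

theory Submission
  imports Defs
begin

text \<open>
  Each \<open>p\<^sub>j\<close> divides the Fermat number \<open>2^(2^(j-1)) + 1\<close>, so \<open>2^n \<equiv> -1 (mod p\<^sub>j)\<close> whenever
  \<open>2^(j-1)\<close> is the exact power of 2 dividing \<open>n\<close>. Hence an odd \<open>k\<close> with \<open>k \<equiv> -1 (mod P)\<close> and
  \<open>k \<equiv> 1 (mod q)\<close> has \<open>k * 2^n - 1\<close> divisible by some \<open>p\<^sub>j\<close> if \<open>2^\<tau>\<close> does not divide \<open>n\<close>, and by \<open>q\<close>
  otherwise. For \<open>k = 1 + b + \<dots> + b^(t-1)\<close> the first congruence holds as soon as \<open>t \<equiv> -1 (mod P)\<close>, because
  \<open>b \<equiv> 1 (mod P)\<close>, and the second together with oddness holds if \<open>t \<equiv> 1 (mod m)\<close> for a suitable even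
  \<open>m\<close> coprime to \<open>P\<close>: take \<open>m = 2\<close>, \<open>2 q\<close> or \<open>2 ord\<^sub>q(b)\<close> in the three cases. The Chinese
  remainder theorem yields arbitrarily large such \<open>t\<close>.
\<close>

lemma power_eq_geometric_sum_nat:
  fixes b :: nat
  assumes "b > 0"
  shows "b ^ t = (b - 1) * (\<Sum>i<t. b ^ i) + 1"
proof -
  obtain c where "b = Suc c"
    using assms gr0_implies_Suc by blast
  then show ?thesis
    by (induction t) (auto simp: algebra_simps)
qed

lemma repunit_eq_sum: "b > 1 \<Longrightarrow> repunit b t = (\<Sum>i<t. b ^ i)"
  using power_eq_geometric_sum_nat[of b t] by (simp add: repunit_def)

lemma repunit_ge: "b > 1 \<Longrightarrow> t \<le> repunit b t"
  using sum_mono[of "{..<t}" "\<lambda>_. 1" "\<lambda>i. b ^ i"] by (simp add: repunit_eq_sum)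

lemma repunit_cong_exponent:
  assumes "b > 1" "[b = 1] (mod m)"
  shows "[repunit b t = t] (mod m)"
proof -
  have "[(\<Sum>i<t. b ^ i) = (\<Sum>i<t. 1)] (mod m)"
    using cong_pow[OF assms(2)] by (intro cong_sum) simp
  then show ?thesis
    using assms by (simp add: repunit_eq_sum)
qed

text \<open>All powers of \<open>b\<close> with positive exponent have the same parity. Removing the
  leading 1 leaves an even number of them, which the induction adds in pairs.\<close>

lemma odd_repunit:
  assumes "b > 1" "odd t"
  shows "odd (repunit b t)"
proof -
  obtain s where t: "t = Suc (2 * s)"
    using assms(2) by (metis oddE Suc_eq_plus1)
  have "even (\<Sum>i<2 * s. b ^ Suc i)"
    by (induction s) auto
  then show ?thesis
    unfolding repunit_eq_sum[OF assms(1)] t sum.lessThan_Suc_shift by simp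
qed

lemma primitive_prime_divisor_prime: "primitive_prime_divisor p m \<Longrightarrow> prime p"
  by (simp add: primitive_prime_divisor_def)

lemma primitive_prime_divisor_odd:
  assumes "primitive_prime_divisor p m" "m > 0"
  shows "odd p"
proof
  assume "even p"
  then have "even ((2::nat) ^ m - 1)"
    using assms(1) dvd_trans unfolding primitive_prime_divisor_def by blast
  then show False
    using assms(2) by simp
qed

lemma primitive_prime_divisor_inj:
  assumes "primitive_prime_divisor p m" "primitive_prime_divisor p n" "m > 0" "n > 0"
  shows "m = n"
  using assms unfolding primitive_prime_divisor_def by (metis linorder_neqE_nat)

text \<open>Difference of squares: primitivity keeps \<open>p\<close> away from the factor
  \<open>2 ^ 2 ^ i - 1\<close>, so the prime \<open>p\<close> divides the other one.\<close>

lemma primitive_prime_divisor_dvd_fermat: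
  assumes "primitive_prime_divisor p (2 ^ Suc i)"
  shows "p dvd 2 ^ 2 ^ i + 1"
proof -
  have "(2::nat) ^ 2 ^ Suc i - 1 = (2 ^ 2 ^ i - 1) * (2 ^ 2 ^ i + 1)"
    by (simp add: algebra_simps power_mult power2_eq_square mult_2 power_add)
  moreover have "\<not> p dvd 2 ^ 2 ^ i - 1"
    using assms unfolding primitive_prime_divisor_def by simp
  ultimately show ?thesis
    using assms unfolding primitive_prime_divisor_def by (metis prime_dvd_mult_iff)
qed

text \<open>Modulo \<open>a + 1\<close> one has a \<equiv> -1, and an odd power of -1 is -1; the
  integers are used to have -1 available.\<close>

lemma Suc_dvd_Suc_power_odd:
  fixes a :: nat
  assumes "odd u"
  shows "a + 1 dvd a ^ u + 1"
proof -
  have "[int a ^ u = (- 1) ^ u] (mod (int a + 1))"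
    by (intro cong_pow) (simp add: cong_iff_dvd_diff)
  then have "int a + 1 dvd int a ^ u + 1"
    using assms by (simp add: cong_iff_dvd_diff)
  then have "int (a + 1) dvd int (a ^ u + 1)"
    by (simp add: add.commute)
  then show ?thesis
    by (simp only: int_dvd_int_iff)
qed

text \<open>The congruences give a prime divisor of each \<open>k * 2 ^ n - 1\<close>; the bounds in
  \<open>large\<close> ensure that this divisor is proper.\<close>

lemma riesel_covering:
  fixes k q \<tau> :: nat and p :: "nat \<Rightarrow> nat"
  assumes p: "\<And>j. 1 \<le> j \<Longrightarrow> j \<le> \<tau> \<Longrightarrow> primitive_prime_divisor (p j) (2 ^ j)"
    and q: "primitive_prime_divisor q (2 ^ \<tau>)"
    and kp: "\<And>j. 1 \<le> j \<Longrightarrow> j \<le> \<tau> \<Longrightarrow> p j dvd k + 1"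
    and kq: "[k = 1] (mod q)"
    and large: "\<And>j. 1 \<le> j \<Longrightarrow> j \<le> \<tau> \<Longrightarrow> p j < k" "q < k"
    and "odd k"
  shows "riesel k"
  unfolding riesel_def
proof (intro conjI allI impI)
  show "odd k" by fact
next
  fix n :: nat
  assume n: "n > 0"
  have "\<exists>r. prime r \<and> r < k \<and> r dvd k * 2 ^ n - 1"
  proof (cases "2 ^ \<tau> dvd n")
    case True
    then obtain u where u: "n = 2 ^ \<tau> * u" ..
    have "[2 ^ 2 ^ \<tau> = 1] (mod q)"
      using q unfolding primitive_prime_divisor_def
      by (subst cong_altdef_nat) auto
    then have "[k * (2 ^ 2 ^ \<tau>) ^ u = 1 * 1 ^ u] (mod q)"
      by (intro cong_mult cong_pow kq)
    then have "[k * 2 ^ n = 1] (mod q)"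
      by (simp add: u power_mult)
    moreover have "1 \<le> k * 2 ^ n"
      using \<open>odd k\<close> by (simp add: Suc_le_eq odd_pos)
    ultimately have "q dvd k * 2 ^ n - 1"
      by (simp add: cong_altdef_nat)
    then show ?thesis
      using primitive_prime_divisor_prime[OF q] large(2) by blast
  next
    case False
    define i where "i = multiplicity 2 n"
    obtain u where u: "n = 2 ^ i * u" "odd u"
      unfolding i_def using n multiplicity_decompose'[of n 2] by auto
    have "i < \<tau>"
      using False u(1) by (metis dvd_triv_left le_imp_power_dvd dvd_trans not_le)
    then have j: "1 \<le> Suc i" "Suc i \<le> \<tau>" by auto
    have "p (Suc i) dvd (2 ^ 2 ^ i) ^ u + 1"
      using primitive_prime_divisor_dvd_fermat[OF p[OF j]] Suc_dvd_Suc_power_odd[OF u(2)]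
      by (rule dvd_trans)
    then have "p (Suc i) dvd 2 ^ n + 1"
      by (simp add: u(1) power_mult)
    \<comment> \<open>This difference equals \<open>k * 2 ^ n - 1\<close>.\<close>
    then have "p (Suc i) dvd (k + 1) * 2 ^ n - (2 ^ n + 1)"
      using kp[OF j] by (intro dvd_diff_nat dvd_mult2)
    then have "p (Suc i) dvd k * 2 ^ n - 1"
      by (simp add: algebra_simps)
    then show ?thesis
      using primitive_prime_divisor_prime[OF p[OF j]] large(1)[OF j] by blast
  qed
  then obtain r where r: "prime r" "r < k" "r dvd k * 2 ^ n - 1"
    by blast
  \<comment> \<open>Since \<open>n > 0\<close>, the number \<open>k * 2 ^ n - 1\<close> is at least
    2k - 1 \<ge> k > r.\<close>
  have "k * 2 \<le> k * 2 ^ n"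
    using n by (cases n) auto
  with r(2) have gt: "r < k * 2 ^ n - 1"
    by linarith
  then have "\<not> prime (k * 2 ^ n - 1)"
    using r by (metis prime_nat_iff less_irrefl)
  then show "composite (k * 2 ^ n - 1)"
    using gt prime_gt_1_nat[OF r(1)] unfolding composite_def by linarith
qed

theorem theorem3p13:
  fixes \<tau> q P b :: nat and p :: "nat \<Rightarrow> nat"
  assumes "\<tau> > 0"
    and "\<exists>r s. r \<noteq> s \<and> primitive_prime_divisor r (2 ^ \<tau>) \<and> primitive_prime_divisor s (2 ^ \<tau>)"
    and "\<And>j. 1 \<le> j \<Longrightarrow> j \<le> \<tau> \<Longrightarrow> primitive_prime_divisor (p j) (2 ^ j)"
    and "primitive_prime_divisor q (2 ^ \<tau>)" and "q \<noteq> p \<tau>"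
    and "P = (\<Prod>j=1..\<tau>. p j)"
    and "b > 2" and "[b = 1] (mod P)"
    and "[b = 0] (mod q) \<or> [b = 1] (mod q) \<or>
         (\<not> [b = 0] (mod q) \<and> \<not> [b = 1] (mod q) \<and> gcd P (ord q b) = 1)"
  shows "infinite {N. (\<exists>t\<ge>1. N = repunit b t) \<and> riesel N}"
proof -
  note p = assms(3) and q = assms(4)
  have b: "b > 1" using assms(7) by simp
  have "prime q" using q by (rule primitive_prime_divisor_prime)
  have p_dvd: "p j dvd P" if "1 \<le> j" "j \<le> \<tau>" for j
    unfolding assms(6) using that by (intro dvd_prodI) auto
  have "odd P"
    unfolding assms(6) using primitive_prime_divisor_odd[OF p]
    by (auto simp: even_prod_iff)
  then have "P > 0" and coprime_2: "coprime P 2"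
    by (auto simp: odd_pos)
  \<comment> \<open>If \<open>q = p j\<close>, equal primitive exponents force j = \<tau>, which the
    hypothesis on \<open>q\<close> excludes.\<close>
  have "q \<noteq> p j" if "1 \<le> j" "j \<le> \<tau>" for j
    using primitive_prime_divisor_inj[of q "2 ^ j" "2 ^ \<tau>"] p[OF that] q assms(5) by auto
  then have coprime_q: "coprime P q"
    unfolding assms(6) using \<open>prime q\<close> p
    by (intro prod_coprime_left)
       (metis atLeastAtMost_iff primes_coprime primitive_prime_divisor_prime)

  obtain m where m: "coprime P m" "even m" "m > 0"
    and mq: "\<And>t. t \<ge> 1 \<Longrightarrow> [t = 1] (mod m) \<Longrightarrow> [repunit b t = 1] (mod q)"
  proof -
    consider "[b = 0] (mod q)" | "[b = 1] (mod q)"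
      | "\<not> [b = 0] (mod q)" "\<not> [b = 1] (mod q)" "gcd P (ord q b) = 1"
      using assms(9) by blast
    then show ?thesis
    proof cases
      case 1
      \<comment> \<open>Every term except \<open>b ^ 0\<close> vanishes modulo \<open>q\<close>, so
        \<open>m = 2\<close> is needed only for parity.\<close>
      have "[repunit b t = 1] (mod q)" if t: "t \<ge> 1" for t
      proof -
        obtain s where s: "t = Suc s"
          using t by (cases t) auto
        have "q dvd (\<Sum>i<s. b ^ Suc i)"
          using 1 by (intro dvd_sum) (auto simp: cong_0_iff)
        then have "[1 + (\<Sum>i<s. b ^ Suc i) = 1 + 0] (mod q)"
          by (intro cong_add) (auto simp: cong_0_iff)
        then show ?thesis
          unfolding repunit_eq_sum[OF b] s sum.lessThan_Suc_shift by simp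
      qed
      with that[of 2] coprime_2 show ?thesis by simp
    next
      case 2
      \<comment> \<open>Here the repunit is congruent to \<open>t\<close> itself modulo
        \<open>q\<close>.\<close>
      have "[repunit b t = 1] (mod q)" if "[t = 1] (mod 2 * q)" for t
        using repunit_cong_exponent[OF b 2] cong_modulus_mult_nat[of t 1 q 2] that
        by (metis cong_trans mult.commute)
      with that[of "2 * q"] coprime_2 coprime_q \<open>prime q\<close> show ?thesis
        by (simp add: prime_gt_0_nat)
    next
      case 3
      have "coprime q b"
        using 3(1) \<open>prime q\<close> by (simp add: cong_0_iff prime_imp_coprime)
      have "\<not> q dvd b - 1"
        using 3(2) b by (simp add: cong_altdef_nat)
      then have coprime: "coprime (b - 1) q"
        using \<open>prime q\<close> by (metis coprime_commute prime_imp_coprime)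
      \<comment> \<open>Now \<open>b ^ t\<close> is congruent to \<open>b\<close>, so
        \<open>(b - 1) * repunit b t\<close> is congruent to \<open>b - 1\<close>, and
        \<open>b - 1\<close> is invertible modulo \<open>q\<close>.\<close>
      have "[repunit b t = 1] (mod q)" if "[t = 1] (mod 2 * ord q b)" for t
      proof -
        have "[t = 1] (mod ord q b)"
          using that by (metis cong_modulus_mult_nat mult.commute)
        then have "[b ^ t = b ^ 1] (mod q)"
          using \<open>coprime q b\<close> by (subst order_divides_expdiff) auto
        moreover have "b ^ t = (b - 1) * repunit b t + 1"
          using b power_eq_geometric_sum_nat[of b t] by (simp add: repunit_eq_sum)
        moreover have "b ^ 1 = (b - 1) * 1 + 1"
          using b by simp
        ultimately have "[(b - 1) * repunit b t = (b - 1) * 1] (mod q)"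
          by (metis cong_add_rcancel_nat)
        then show ?thesis
          using coprime by (simp only: cong_mult_lcancel_nat)
      qed
      moreover have "coprime P (2 * ord q b)"
        using coprime_2 3(3)[folded coprime_iff_gcd_eq_1] by simp
      moreover have "ord q b > 0"
        using \<open>coprime q b\<close> by (metis gr0I ord_eq_0)
      ultimately show ?thesis
        using that[of "2 * ord q b"] by simp
    qed
  qed

  \<comment> \<open>\<open>P - 1\<close> stands for -1 in the naturals.\<close>
  obtain t0 where t0: "[t0 = P - 1] (mod P)" "[t0 = 1] (mod m)"
    using binary_chinese_remainder_nat[OF m(1)] by blast
  show ?thesis
    unfolding infinite_nat_iff_unbounded
  proof
    fix B
    \<comment> \<open>Adding a multiple of \<open>P * m\<close> keeps both congruences. The last
      factor pushes \<open>t\<close>, hence the repunit, beyond \<open>B\<close> and beyond every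
      covering prime.\<close>
    define t where "t = t0 + P * m * (B + P + q + 1)"
    have "B + P + q + 1 \<le> P * m * (B + P + q + 1)"
      using \<open>P > 0\<close> m(3) by (intro mult_le_mono[of 1, simplified]) auto
    then have large: "B + P + q < t"
      unfolding t_def by linarith
    have "[t = t0] (mod P * m)"
      unfolding t_def cong_def by (rule mod_mult_self2)
    then have tP: "[t = P - 1] (mod P)" and tm: "[t = 1] (mod m)"
      using t0 by (metis cong_modulus_mult_nat cong_trans mult.commute)+
    define k where "k = repunit b t"
    have "t \<le> k"
      unfolding k_def by (rule repunit_ge[OF b])
    \<comment> \<open>The evenness of \<open>m\<close> reduces the congruence to one modulo
      2.\<close>
    have "odd t"
      using tm m(2) by (metis cong_dvd_iff cong_dvd_modulus_nat odd_one)
    have "[k = P - 1] (mod P)"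
      unfolding k_def using repunit_cong_exponent[OF b assms(8)] tP by (rule cong_trans)
    then have "[k + 1 = P - 1 + 1] (mod P)"
      by (intro cong_add) auto
    then have "P dvd k + 1"
      using \<open>P > 0\<close> by (simp add: cong_def dvd_eq_mod_eq_0)
    have "riesel k"
    proof (rule riesel_covering[OF p q])
      show "p j dvd k + 1" if "1 \<le> j" "j \<le> \<tau>" for j
        using p_dvd[OF that] \<open>P dvd k + 1\<close> by (rule dvd_trans)
      show "[k = 1] (mod q)"
        unfolding k_def using large tm by (intro mq) auto
      show "p j < k" if "1 \<le> j" "j \<le> \<tau>" for j
        using dvd_imp_le[OF p_dvd[OF that] \<open>P > 0\<close>] large \<open>t \<le> k\<close> by linarith
      show "q < k"
        using large \<open>t \<le> k\<close> by linarith
      show "odd k"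
        unfolding k_def using b \<open>odd t\<close> by (rule odd_repunit)
    qed
    moreover have "1 \<le> t" "B < k"
      using large \<open>t \<le> k\<close> by linarith+
    ultimately show "\<exists>N>B. N \<in> {N. (\<exists>t\<ge>1. N = repunit b t) \<and> riesel N}"
      unfolding k_def by blast
  qed
qed

end
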